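(* Let $R$ be a commutative ring with identity and let $S$ be a multiplicative subset of $R$. 1. If an $R$-module $M$ is c-$S$-finitely presented, then $M_S$ is a finitely presented $R_S$-module. 2. A finitely generated $R$-module $M$ is c-$S$-finitely presented if and only if there is a finitely presented submodule $N$ of $M$ such that $M_S=N_S$.
   Context: All rings are commutative with identity and all modules are unitary. A multiplicative subset of $R$ is a subset containing $1$ and closed under multiplication. $R_S$ and $M_S$ denote localizations at $S$; for a submodule $N\subseteq M$, $N_S$ is viewed as a submodule of $M_S$. An $R$-module $M$ is c-$S$-finitely presented if there exist a finitely presented submodule $N$ of $M$ and $s\in S$ such that $sM\subseteq N\subseteq M$. *)

theory Defs
  imports "Jordan_Normal_Form.Missing_VectorSpace"
begin

text \<open>
  Commutative rings and modules are those of HOL-Algebra (locales \<^locale>\<open>cring\<close> and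
  \<^locale>\<open>module\<close>, which includes \<^locale>\<open>cring\<close>). Submodules (\<^locale>\<open>submodule\<close>), spans,
  homomorphisms (\<^locale>\<open>mod_hom\<close>) and function modules are those of the AFP entry VectorSpace.
  A submodule is a subset \<open>N\<close> of \<open>carrier M\<close>; as a module in its own right it is
  \<open>M\<lparr>carrier := N\<rparr>\<close>. A multiplicative subset \<open>S\<close> of \<open>R\<close> is given by \<open>submonoid S R\<close>.
\<close>

section \<open>Finitely generated and finitely presented modules\<close>

definition fin_generated :: "('a, 'r) ring_scheme \<Rightarrow> ('a, 'b, 'm) module_scheme \<Rightarrow> bool" where
  "fin_generated R M \<longleftrightarrow>
     module R M \<and> (\<exists>A. finite A \<and> A \<subseteq> carrier M \<and> module.span R M A = carrier M)"

abbreviation free_mod :: "('a, 'r) ring_scheme \<Rightarrow> nat \<Rightarrow> ('a, nat \<Rightarrow> 'a) module" where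
  "free_mod R n \<equiv> ring.func_space R {..<n}"

text \<open>There is an exact sequence \<open>0 \<rightarrow> K \<rightarrow> R\<^sup>n \<rightarrow> M \<rightarrow> 0\<close> with \<open>K\<close> finitely generated.\<close>

definition fin_presented :: "('a, 'r) ring_scheme \<Rightarrow> ('a, 'b, 'm) module_scheme \<Rightarrow> bool" where
  "fin_presented R M \<longleftrightarrow>
     (\<exists>n f. mod_hom R (free_mod R n) M f
          \<and> mod_hom.im (free_mod R n) f = carrier M
          \<and> fin_generated R ((free_mod R n)\<lparr>carrier := mod_hom.ker (free_mod R n) M f\<rparr>))"

definition c_S_fin_presented ::
    "('a, 'r) ring_scheme \<Rightarrow> 'a set \<Rightarrow> ('a, 'b, 'm) module_scheme \<Rightarrow> bool" where
  "c_S_fin_presented R S M \<longleftrightarrow>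
     (\<exists>N s. submodule R N M \<and> fin_presented R (M\<lparr>carrier := N\<rparr>)
          \<and> s \<in> S \<and> (\<lambda>x. s \<odot>\<^bsub>M\<^esub> x) ` carrier M \<subseteq> N)"

section \<open>Localization of rings\<close>

definition ring_frac_rel ::
    "('a, 'r) ring_scheme \<Rightarrow> 'a set \<Rightarrow> (('a \<times> 'a) \<times> ('a \<times> 'a)) set" where
  "ring_frac_rel R S =
     {((a, s), (b, t)). a \<in> carrier R \<and> b \<in> carrier R \<and> s \<in> S \<and> t \<in> S \<and>
        (\<exists>u\<in>S. u \<otimes>\<^bsub>R\<^esub> (t \<otimes>\<^bsub>R\<^esub> a) = u \<otimes>\<^bsub>R\<^esub> (s \<otimes>\<^bsub>R\<^esub> b))}"

definition ring_frac :: "('a, 'r) ring_scheme \<Rightarrow> 'a set \<Rightarrow> 'a \<Rightarrow> 'a \<Rightarrow> ('a \<times> 'a) set" where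
  "ring_frac R S a s = ring_frac_rel R S `` {(a, s)}"

text \<open>
  The operations are the unions, over all representatives of the arguments, of the class given by
  the usual formula; these classes all coincide, hence so does their union.
\<close>

definition loc_ring :: "('a, 'r) ring_scheme \<Rightarrow> 'a set \<Rightarrow> ('a \<times> 'a) set ring" where
  "loc_ring R S =
     \<lparr>carrier = (carrier R \<times> S) // ring_frac_rel R S,
      mult = (\<lambda>X Y. \<Union>(a, s)\<in>X. \<Union>(b, t)\<in>Y. ring_frac R S (a \<otimes>\<^bsub>R\<^esub> b) (s \<otimes>\<^bsub>R\<^esub> t)),
      one = ring_frac R S \<one>\<^bsub>R\<^esub> \<one>\<^bsub>R\<^esub>,
      zero = ring_frac R S \<zero>\<^bsub>R\<^esub> \<one>\<^bsub>R\<^esub>,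
      add = (\<lambda>X Y. \<Union>(a, s)\<in>X. \<Union>(b, t)\<in>Y.
               ring_frac R S (t \<otimes>\<^bsub>R\<^esub> a \<oplus>\<^bsub>R\<^esub> s \<otimes>\<^bsub>R\<^esub> b) (s \<otimes>\<^bsub>R\<^esub> t))\<rparr>"

section \<open>Localization of modules\<close>

definition mod_frac_rel ::
    "('a, 'r) ring_scheme \<Rightarrow> 'a set \<Rightarrow> ('a, 'b, 'm) module_scheme \<Rightarrow>
       (('b \<times> 'a) \<times> ('b \<times> 'a)) set" where
  "mod_frac_rel R S M =
     {((x, s), (y, t)). x \<in> carrier M \<and> y \<in> carrier M \<and> s \<in> S \<and> t \<in> S \<and>
        (\<exists>u\<in>S. u \<odot>\<^bsub>M\<^esub> (t \<odot>\<^bsub>M\<^esub> x) = u \<odot>\<^bsub>M\<^esub> (s \<odot>\<^bsub>M\<^esub> y))}"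

definition mod_frac ::
    "('a, 'r) ring_scheme \<Rightarrow> 'a set \<Rightarrow> ('a, 'b, 'm) module_scheme \<Rightarrow> 'b \<Rightarrow> 'a \<Rightarrow>
       ('b \<times> 'a) set" where
  "mod_frac R S M x s = mod_frac_rel R S M `` {(x, s)}"

text \<open>
  The localization of \<open>M\<close> as a module over \<^term>\<open>loc_ring R S\<close>. The fields \<open>mult\<close> and \<open>one\<close>, which
  the module record inherits from the ring record, play no role in a module.
\<close>

definition loc_mod ::
    "('a, 'r) ring_scheme \<Rightarrow> 'a set \<Rightarrow> ('a, 'b, 'm) module_scheme \<Rightarrow>
       (('a \<times> 'a) set, ('b \<times> 'a) set) module" where
  "loc_mod R S M =
     \<lparr>carrier = (carrier M \<times> S) // mod_frac_rel R S M,
      mult = (\<lambda>X Y. mod_frac R S M \<zero>\<^bsub>M\<^esub> \<one>\<^bsub>R\<^esub>),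
      one = mod_frac R S M \<zero>\<^bsub>M\<^esub> \<one>\<^bsub>R\<^esub>,
      zero = mod_frac R S M \<zero>\<^bsub>M\<^esub> \<one>\<^bsub>R\<^esub>,
      add = (\<lambda>X Y. \<Union>(x, s)\<in>X. \<Union>(y, t)\<in>Y.
               mod_frac R S M (t \<odot>\<^bsub>M\<^esub> x \<oplus>\<^bsub>M\<^esub> s \<odot>\<^bsub>M\<^esub> y) (s \<otimes>\<^bsub>R\<^esub> t)),
      smult = (\<lambda>X Y. \<Union>(a, s)\<in>X. \<Union>(y, t)\<in>Y. mod_frac R S M (a \<odot>\<^bsub>M\<^esub> y) (s \<otimes>\<^bsub>R\<^esub> t))\<rparr>"

text \<open>
  For a submodule \<open>N\<close> of \<open>M\<close>, the localization of \<open>N\<close> viewed as a submodule of that of \<open>M\<close>, that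
  is, the image of the (injective) map \<open>N\<^sub>S \<rightarrow> M\<^sub>S\<close>. The fractions here are classes
  of the relation on \<open>M \<times> S\<close>, so they are elements of \<open>carrier (loc_mod R S M)\<close>.
\<close>

definition loc_submod ::
    "('a, 'r) ring_scheme \<Rightarrow> 'a set \<Rightarrow> ('a, 'b, 'm) module_scheme \<Rightarrow> 'b set \<Rightarrow>
       ('b \<times> 'a) set set" where
  "loc_submod R S M N = {mod_frac R S M x s | x s. x \<in> N \<and> s \<in> S}"

end

theory Submission
  imports Defs
begin

text \<open>
  Let \<open>f : R\<^sup>n \<rightarrow> N\<close> be a presentation of a submodule \<open>N\<close> of \<open>M\<close> such that every element of
  \<open>M\<close> has a multiple by an element of \<open>S\<close> in \<open>N\<close>. Every vector over \<open>R\<^sub>S\<close> is a fraction \<open>v/s\<close> with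
  \<open>v \<in> R\<^sup>n\<close>, and \<open>v/s \<mapsto> f v/s\<close> is a presentation of \<open>M\<^sub>S\<close>: it is surjective because
  \<open>x/t = (s x)/(s t)\<close>, and its kernel is generated by the \<open>a/1\<close>, where \<open>a\<close> runs over generators of the
  kernel of \<open>f\<close>. Moreover \<open>M\<^sub>S = N\<^sub>S\<close> says precisely that every element of \<open>M\<close> has
  such a multiple in \<open>N\<close>; if \<open>M\<close> is finitely generated, the product of the multipliers
  of the generators serves for all of \<open>M\<close>.
\<close>

text \<open>The operations on classes are unions over all representatives. Once the formula is known
  to be independent of the representatives, the union collapses to any one value; the two
  memberships ensure that neither index set is empty.\<close>

lemma UN_pairs_const:
  assumes "(a, s) \<in> X" "(b, t) \<in> Y"
    and "\<And>a s b t. (a, s) \<in> X \<Longrightarrow> (b, t) \<in> Y \<Longrightarrow> F a s b t = C"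
  shows "(\<Union>(a, s)\<in>X. \<Union>(b, t)\<in>Y. F a s b t) = C"
proof -
  have "(\<Union>(a, s)\<in>X. \<Union>(b, t)\<in>Y. F a s b t) = (\<Union>p\<in>X. \<Union>q\<in>Y. C)"
    using assms(3) by (intro SUP_cong refl) auto
  also have "\<dots> = C" using assms(1,2) by blast
  finally show ?thesis .
qed

section \<open>Multiplicative subsets and common multiples\<close>

locale localized_cring = R?: cring R for R (structure) and S +
  assumes submonoid_S: "submonoid S R"
begin

abbreviation rfrac where "rfrac \<equiv> ring_frac R S"
abbreviation LR where "LR \<equiv> loc_ring R S"

lemma S_carrier [simp]: "s \<in> S \<Longrightarrow> s \<in> carrier R"
  using submonoid.mem_carrier[OF submonoid_S] by blast

lemma one_S [simp, intro]: "\<one> \<in> S"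
  using submonoid.one_closed[OF submonoid_S] .

lemma mult_S [simp]: "s \<in> S \<Longrightarrow> t \<in> S \<Longrightarrow> s \<otimes> t \<in> S"
  using submonoid.m_closed[OF submonoid_S] .

text \<open>The product of individual witnesses serves for the whole finite family, because
  \<open>mono\<close> lets \<open>P i\<close> survive multiplication by \<open>S\<close>. This
  yields common denominators, a single multiplier for an equality of vectors, and a multiplier
  uniform over finitely many generators.\<close>

lemma common_multiple_S:
  assumes "finite I" and "\<And>i. i \<in> I \<Longrightarrow> \<exists>s\<in>S. P i s"
    and mono: "\<And>i s t. i \<in> I \<Longrightarrow> P i s \<Longrightarrow> s \<in> S \<Longrightarrow> t \<in> S \<Longrightarrow> P i (t \<otimes> s)"
  shows "\<exists>s\<in>S. \<forall>i\<in>I. P i s"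
  using assms
proof (induction I rule: finite_induct)
  case empty
  then show ?case by auto
next
  case (insert i I)
  then obtain s where s: "s \<in> S" "\<forall>j\<in>I. P j s" by blast
  from insert obtain t where t: "t \<in> S" "P i t" by blast
  have "P j (t \<otimes> s)" if "j \<in> I" for j using s t that insert.prems by blast
  moreover have "P i (s \<otimes> t)" using s t insert.prems by blast
  \<comment> \<open>\<open>mono\<close> multiplies on the left only, so the old indices yield
    \<open>t \<otimes> s\<close> and the new one \<open>s \<otimes> t\<close>.\<close>
  moreover have "s \<otimes> t = t \<otimes> s" using s t by (simp add: R.m_comm)
  ultimately show ?case using s t by (metis insert_iff mult_S)
qed

end

section \<open>Fractions with numerators in a module, and their additive group\<close>

locale localized_module = localized_cring R S + module R M for R (structure) and S and M (structure)
begin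

abbreviation frac where "frac \<equiv> mod_frac R S M"
abbreviation LM where "LM \<equiv> loc_mod R S M"

lemma mod_frac_rel_iff:
  "((x, s), (y, t)) \<in> mod_frac_rel R S M \<longleftrightarrow>
     x \<in> carrier M \<and> y \<in> carrier M \<and> s \<in> S \<and> t \<in> S \<and>
     (\<exists>u\<in>S. u \<odot>\<^bsub>M\<^esub> (t \<odot>\<^bsub>M\<^esub> x) = u \<odot>\<^bsub>M\<^esub> (s \<odot>\<^bsub>M\<^esub> y))"
  by (simp add: mod_frac_rel_def)

lemma smult_left_commute:
  "a \<in> carrier R \<Longrightarrow> b \<in> carrier R \<Longrightarrow> x \<in> carrier M \<Longrightarrow>
    a \<odot>\<^bsub>M\<^esub> (b \<odot>\<^bsub>M\<^esub> x) = b \<odot>\<^bsub>M\<^esub> (a \<odot>\<^bsub>M\<^esub> x)"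
  by (metis smult_assoc1 R.m_comm)

lemma equiv_mod_frac_rel: "equiv (carrier M \<times> S) (mod_frac_rel R S M)"
proof (rule equivI)
  show "mod_frac_rel R S M \<subseteq> (carrier M \<times> S) \<times> (carrier M \<times> S)"
    by (auto simp: mod_frac_rel_def)
  show "refl_on (carrier M \<times> S) (mod_frac_rel R S M)"
    by (auto simp: refl_on_def mod_frac_rel_def)
  show "sym (mod_frac_rel R S M)"
    unfolding sym_def by (clarsimp simp: mod_frac_rel_iff) metis
  show "trans (mod_frac_rel R S M)"
  proof (rule transI, clarify)
    fix x s y t z r
    assume "((x, s), (y, t)) \<in> mod_frac_rel R S M" "((y, t), (z, r)) \<in> mod_frac_rel R S M"
    then obtain u w where xyz: "x \<in> carrier M" "y \<in> carrier M" "z \<in> carrier M"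
      and S: "s \<in> S" "t \<in> S" "r \<in> S" "u \<in> S" "w \<in> S"
      and u: "u \<odot>\<^bsub>M\<^esub> (t \<odot>\<^bsub>M\<^esub> x) = u \<odot>\<^bsub>M\<^esub> (s \<odot>\<^bsub>M\<^esub> y)"
      and w: "w \<odot>\<^bsub>M\<^esub> (r \<odot>\<^bsub>M\<^esub> y) = w \<odot>\<^bsub>M\<^esub> (t \<odot>\<^bsub>M\<^esub> z)"
      by (auto simp: mod_frac_rel_iff)
    \<comment> \<open>Besides \<open>u\<close> and \<open>w\<close>, the witness contains the middle
      denominator \<open>t\<close>: the first equation involves \<open>t \<odot> x\<close>, and the
      second one produces \<open>t \<odot> z\<close>.\<close>
    have "(u \<otimes> w \<otimes> t) \<odot>\<^bsub>M\<^esub> (r \<odot>\<^bsub>M\<^esub> x) = w \<odot>\<^bsub>M\<^esub> (r \<odot>\<^bsub>M\<^esub> (u \<odot>\<^bsub>M\<^esub> (t \<odot>\<^bsub>M\<^esub> x)))"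
      using xyz S by (simp add: smult_assoc_simp R.m_ac)
    also have "\<dots> = u \<odot>\<^bsub>M\<^esub> (s \<odot>\<^bsub>M\<^esub> (w \<odot>\<^bsub>M\<^esub> (r \<odot>\<^bsub>M\<^esub> y)))"
      unfolding u using xyz S by (simp add: smult_assoc_simp R.m_ac)
    also have "\<dots> = (u \<otimes> w \<otimes> t) \<odot>\<^bsub>M\<^esub> (s \<odot>\<^bsub>M\<^esub> z)"
      unfolding w using xyz S by (simp add: smult_assoc_simp R.m_ac)
    finally show "((x, s), (z, r)) \<in> mod_frac_rel R S M"
      using xyz S by (auto simp: mod_frac_rel_iff)
  qed
qed

lemma frac_eq_iff:
  assumes "x \<in> carrier M" "s \<in> S" "y \<in> carrier M" "t \<in> S"
  shows "frac x s = frac y t \<longleftrightarrow> (\<exists>u\<in>S. u \<odot>\<^bsub>M\<^esub> (t \<odot>\<^bsub>M\<^esub> x) = u \<odot>\<^bsub>M\<^esub> (s \<odot>\<^bsub>M\<^esub> y))"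
  unfolding mod_frac_def
  using eq_equiv_class_iff[OF equiv_mod_frac_rel, of "(x, s)" "(y, t)"] assms
  by (simp add: mod_frac_rel_iff)

lemma frac_eqI:
  assumes "x \<in> carrier M" "s \<in> S" "y \<in> carrier M" "t \<in> S"
    and "t \<odot>\<^bsub>M\<^esub> x = s \<odot>\<^bsub>M\<^esub> y"
  shows "frac x s = frac y t"
  using assms frac_eq_iff by auto

text \<open>Read from right to left, this expands a fraction; that is how denominators are equalized
  and how numerators are moved into a submodule.\<close>

lemma frac_cancel:
  assumes "x \<in> carrier M" "s \<in> S" "t \<in> S"
  shows "frac (t \<odot>\<^bsub>M\<^esub> x) (t \<otimes> s) = frac x s"
  using assms by (intro frac_eqI) (auto simp: smult_assoc_simp R.m_ac)

lemma frac_eq_zero_iff: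
  assumes "x \<in> carrier M" "s \<in> S"
  shows "frac x s = \<zero>\<^bsub>LM\<^esub> \<longleftrightarrow> (\<exists>u\<in>S. u \<odot>\<^bsub>M\<^esub> x = \<zero>\<^bsub>M\<^esub>)"
  using assms by (auto simp: loc_mod_def frac_eq_iff)

lemma frac_zero: "s \<in> S \<Longrightarrow> frac \<zero>\<^bsub>M\<^esub> s = \<zero>\<^bsub>LM\<^esub>"
  using frac_eq_zero_iff by auto

text \<open>The relation lives on \<open>carrier M \<times> S\<close>, so the class of a pair
  outside this set is empty; hence the conditions on \<open>x\<close> and \<open>s\<close> on the
  right.\<close>

lemma frac_mem: "(y, t) \<in> frac x s \<longleftrightarrow> x \<in> carrier M \<and> s \<in> S \<and> y \<in> carrier M \<and> t \<in> S \<and> frac y t = frac x s"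
  unfolding mod_frac_def
  using eq_equiv_class_iff[OF equiv_mod_frac_rel, of "(x, s)" "(y, t)"] 
  by (auto simp: mod_frac_rel_iff)

lemma carrier_loc_mod: "carrier LM = {frac x s | x s. x \<in> carrier M \<and> s \<in> S}"
  by (auto simp: loc_mod_def quotient_def mod_frac_def)

lemma frac_closed [simp, intro]: "x \<in> carrier M \<Longrightarrow> s \<in> S \<Longrightarrow> frac x s \<in> carrier LM"
  by (auto simp: carrier_loc_mod)

lemma frac_cases:
  assumes "X \<in> carrier LM"
  obtains x s where "x \<in> carrier M" "s \<in> S" "X = frac x s"
  using assms by (auto simp: carrier_loc_mod)

lemma frac_add:
  assumes "x \<in> carrier M" "s \<in> S" "y \<in> carrier M" "t \<in> S"
  shows "frac x s \<oplus>\<^bsub>LM\<^esub> frac y t = frac (t \<odot>\<^bsub>M\<^esub> x \<oplus>\<^bsub>M\<^esub> s \<odot>\<^bsub>M\<^esub> y) (s \<otimes> t)"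
proof -
  have wd: "frac (t' \<odot>\<^bsub>M\<^esub> x' \<oplus>\<^bsub>M\<^esub> s' \<odot>\<^bsub>M\<^esub> y') (s' \<otimes> t') = frac (t \<odot>\<^bsub>M\<^esub> x \<oplus>\<^bsub>M\<^esub> s \<odot>\<^bsub>M\<^esub> y) (s \<otimes> t)"
    if "(x', s') \<in> frac x s" "(y', t') \<in> frac y t" for x' s' y' t'
  proof -
    have c: "x' \<in> carrier M" "s' \<in> S" "y' \<in> carrier M" "t' \<in> S"
      and e: "frac x' s' = frac x s" "frac y' t' = frac y t"
      using that by (auto simp: frac_mem)
    obtain u where u: "u \<in> S" "u \<odot>\<^bsub>M\<^esub> (s \<odot>\<^bsub>M\<^esub> x') = u \<odot>\<^bsub>M\<^esub> (s' \<odot>\<^bsub>M\<^esub> x)"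
      using e c assms by (auto simp: frac_eq_iff)
    obtain w where w: "w \<in> S" "w \<odot>\<^bsub>M\<^esub> (t \<odot>\<^bsub>M\<^esub> y') = w \<odot>\<^bsub>M\<^esub> (t' \<odot>\<^bsub>M\<^esub> y)"
      using e c assms by (auto simp: frac_eq_iff)
    \<comment> \<open>The multiplier \<open>u\<close> settles the summand with \<open>x\<close> and
      \<open>w\<close> the one with \<open>y\<close>, so \<open>u \<otimes> w\<close> settles both;
      the two summands are treated separately and then added.\<close>
    have "(u \<otimes> w) \<odot>\<^bsub>M\<^esub> ((s \<otimes> t) \<odot>\<^bsub>M\<^esub> (t' \<odot>\<^bsub>M\<^esub> x')) = (w \<otimes> t \<otimes> t') \<odot>\<^bsub>M\<^esub> (u \<odot>\<^bsub>M\<^esub> (s \<odot>\<^bsub>M\<^esub> x'))"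
      using c assms u(1) w(1) by (simp add: smult_assoc_simp R.m_ac)
    also have "\<dots> = (u \<otimes> w) \<odot>\<^bsub>M\<^esub> ((s' \<otimes> t') \<odot>\<^bsub>M\<^esub> (t \<odot>\<^bsub>M\<^esub> x))"
      unfolding u(2) using c assms u(1) w(1) by (simp add: smult_assoc_simp R.m_ac)
    finally have 1: "(u \<otimes> w) \<odot>\<^bsub>M\<^esub> ((s \<otimes> t) \<odot>\<^bsub>M\<^esub> (t' \<odot>\<^bsub>M\<^esub> x')) =
      (u \<otimes> w) \<odot>\<^bsub>M\<^esub> ((s' \<otimes> t') \<odot>\<^bsub>M\<^esub> (t \<odot>\<^bsub>M\<^esub> x))" .
    have "(u \<otimes> w) \<odot>\<^bsub>M\<^esub> ((s \<otimes> t) \<odot>\<^bsub>M\<^esub> (s' \<odot>\<^bsub>M\<^esub> y')) = (u \<otimes> s \<otimes> s') \<odot>\<^bsub>M\<^esub> (w \<odot>\<^bsub>M\<^esub> (t \<odot>\<^bsub>M\<^esub> y'))"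
      using c assms u(1) w(1) by (simp add: smult_assoc_simp R.m_ac)
    also have "\<dots> = (u \<otimes> w) \<odot>\<^bsub>M\<^esub> ((s' \<otimes> t') \<odot>\<^bsub>M\<^esub> (s \<odot>\<^bsub>M\<^esub> y))"
      unfolding w(2) using c assms u(1) w(1) by (simp add: smult_assoc_simp R.m_ac)
    finally have 2: "(u \<otimes> w) \<odot>\<^bsub>M\<^esub> ((s \<otimes> t) \<odot>\<^bsub>M\<^esub> (s' \<odot>\<^bsub>M\<^esub> y')) =
      (u \<otimes> w) \<odot>\<^bsub>M\<^esub> ((s' \<otimes> t') \<odot>\<^bsub>M\<^esub> (s \<odot>\<^bsub>M\<^esub> y))" .
    have "(u \<otimes> w) \<odot>\<^bsub>M\<^esub> ((s \<otimes> t) \<odot>\<^bsub>M\<^esub> (t' \<odot>\<^bsub>M\<^esub> x' \<oplus>\<^bsub>M\<^esub> s' \<odot>\<^bsub>M\<^esub> y')) =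
       (u \<otimes> w) \<odot>\<^bsub>M\<^esub> ((s' \<otimes> t') \<odot>\<^bsub>M\<^esub> (t \<odot>\<^bsub>M\<^esub> x \<oplus>\<^bsub>M\<^esub> s \<odot>\<^bsub>M\<^esub> y))"
      using c assms u(1) w(1) 1 2 by (simp add: smult_r_distr)
    moreover have "u \<otimes> w \<in> S" using u w by auto
    ultimately show ?thesis
      using c assms by (subst frac_eq_iff) auto
  qed
  have "(x, s) \<in> frac x s" "(y, t) \<in> frac y t" using assms by (auto simp: frac_mem)
  from UN_pairs_const[OF this wd] show ?thesis by (simp add: loc_mod_def)
qed

text \<open>The ring relation is unfolded directly: the identification of \<open>rfrac\<close> with
  module fractions interprets this very locale and so comes only later.\<close>

lemma rfrac_mem:
  "(b, t) \<in> rfrac a s \<longleftrightarrow> a \<in> carrier R \<and> s \<in> S \<and> b \<in> carrier R \<and> t \<in> S \<and>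
     (\<exists>u\<in>S. u \<otimes> (t \<otimes> a) = u \<otimes> (s \<otimes> b))"
  by (auto simp: ring_frac_def ring_frac_rel_def)

lemma frac_smult:
  assumes "a \<in> carrier R" "s \<in> S" "y \<in> carrier M" "t \<in> S"
  shows "rfrac a s \<odot>\<^bsub>LM\<^esub> frac y t = frac (a \<odot>\<^bsub>M\<^esub> y) (s \<otimes> t)"
proof -
  have wd: "frac (a' \<odot>\<^bsub>M\<^esub> y') (s' \<otimes> t') = frac (a \<odot>\<^bsub>M\<^esub> y) (s \<otimes> t)"
    if r: "(a', s') \<in> rfrac a s" and m: "(y', t') \<in> frac y t" for a' s' y' t'
  proof -
    obtain u where u: "u \<in> S" "u \<otimes> (s' \<otimes> a) = u \<otimes> (s \<otimes> a')"
      and c1: "a' \<in> carrier R" "s' \<in> S"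
      using iffD1[OF rfrac_mem r] by blast
    have c2: "y' \<in> carrier M" "t' \<in> S" and e: "frac y' t' = frac y t"
      using m by (auto simp: frac_mem)
    note c = c1 c2
    obtain w where w: "w \<in> S" "w \<odot>\<^bsub>M\<^esub> (t \<odot>\<^bsub>M\<^esub> y') = w \<odot>\<^bsub>M\<^esub> (t' \<odot>\<^bsub>M\<^esub> y)"
      using e c assms by (auto simp: frac_eq_iff)
    \<comment> \<open>The factors are regrouped into a scalar block, on which the equation in
      \<open>R\<close> acts, and a vector block, on which the equation in \<open>M\<close>
      acts.\<close>
    have "(u \<otimes> w) \<odot>\<^bsub>M\<^esub> ((s \<otimes> t) \<odot>\<^bsub>M\<^esub> (a' \<odot>\<^bsub>M\<^esub> y')) = (u \<otimes> (s \<otimes> a')) \<odot>\<^bsub>M\<^esub> (w \<odot>\<^bsub>M\<^esub> (t \<odot>\<^bsub>M\<^esub> y'))"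
      using c assms u(1) w(1) by (simp add: smult_assoc_simp R.m_ac)
    also have "\<dots> = (u \<otimes> (s' \<otimes> a)) \<odot>\<^bsub>M\<^esub> (w \<odot>\<^bsub>M\<^esub> (t' \<odot>\<^bsub>M\<^esub> y))"
      by (simp only: u(2) w(2))
    also have "\<dots> = (u \<otimes> w) \<odot>\<^bsub>M\<^esub> ((s' \<otimes> t') \<odot>\<^bsub>M\<^esub> (a \<odot>\<^bsub>M\<^esub> y))"
      using c assms u(1) w(1) by (simp add: smult_assoc_simp R.m_ac)
    finally show ?thesis
      using c assms u(1) w(1) by (subst frac_eq_iff) auto
  qed
  have "(a, s) \<in> rfrac a s" "(y, t) \<in> frac y t" using assms by (simp_all add: frac_mem rfrac_mem) auto
  from UN_pairs_const[OF this wd] show ?thesis by (simp add: loc_mod_def)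
qed

text \<open>The general formula has denominator \<open>s \<otimes> s\<close> and a common factor
  \<open>s\<close> in the numerator, which cancels. Over a common denominator the group laws of
  \<open>LM\<close> thus become those of \<open>M\<close>.\<close>

lemma frac_add_same:
  assumes "x \<in> carrier M" "y \<in> carrier M" "s \<in> S"
  shows "frac x s \<oplus>\<^bsub>LM\<^esub> frac y s = frac (x \<oplus>\<^bsub>M\<^esub> y) s"
proof -
  have "frac x s \<oplus>\<^bsub>LM\<^esub> frac y s = frac (s \<odot>\<^bsub>M\<^esub> (x \<oplus>\<^bsub>M\<^esub> y)) (s \<otimes> s)"
    using assms by (simp add: frac_add smult_r_distr)
  then show ?thesis using assms by (simp add: frac_cancel)
qed

text \<open>Being expressible with denominator \<open>s\<close> is preserved when \<open>s\<close>
  is multiplied by an element of \<open>S\<close>, by expanding the fraction, so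
  \<open>common_multiple_S\<close> applies.\<close>

lemma common_denominator:
  assumes "finite I" and "c \<in> I \<rightarrow> carrier LM"
  obtains v s where "v \<in> I \<rightarrow> carrier M" "s \<in> S" "\<And>i. i \<in> I \<Longrightarrow> c i = frac (v i) s"
proof -
  have "\<exists>s\<in>S. \<forall>i\<in>I. \<exists>x\<in>carrier M. c i = frac x s"
  proof (rule common_multiple_S[OF assms(1)])
    show "\<exists>s\<in>S. \<exists>x\<in>carrier M. c i = frac x s" if "i \<in> I" for i
      proof -
      have "c i \<in> carrier LM" using assms(2) that by blast
      then obtain x s where "x \<in> carrier M" "s \<in> S" "c i = frac x s" by (rule frac_cases)
      then show ?thesis by blast
    qed
    show "\<exists>x\<in>carrier M. c i = frac x (t \<otimes> s)"
      if ex: "\<exists>x\<in>carrier M. c i = frac x s" and st: "s \<in> S" "t \<in> S" for i s t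
    proof -
      obtain x where x: "x \<in> carrier M" "c i = frac x s" using ex by blast
      then have "c i = frac (t \<odot>\<^bsub>M\<^esub> x) (t \<otimes> s)" using st by (simp only: frac_cancel)
      moreover have "t \<odot>\<^bsub>M\<^esub> x \<in> carrier M" using st x by auto
      ultimately show ?thesis by blast
    qed
  qed
  then obtain s where s: "s \<in> S" "\<forall>i\<in>I. \<exists>x. x \<in> carrier M \<and> c i = frac x s" by blast
  from bchoice[OF s(2)] obtain v where "\<forall>i\<in>I. v i \<in> carrier M \<and> c i = frac (v i) s" ..
  with s(1) show thesis by (intro that[of v s]) auto
qed

lemma common_denominator3:
  assumes "X \<in> carrier LM" "Y \<in> carrier LM" "Z \<in> carrier LM"
  obtains x y z s where "x \<in> carrier M" "y \<in> carrier M" "z \<in> carrier M" "s \<in> S"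
    "X = frac x s" "Y = frac y s" "Z = frac z s"
proof -
  \<comment> \<open>The three classes index themselves, so coincidences among them do no harm; later
    uses for two classes simply repeat one of them.\<close>
  have "finite {X, Y, Z}" "(\<lambda>W. W) \<in> {X, Y, Z} \<rightarrow> carrier LM" using assms by auto
  then obtain v s where v: "v \<in> {X, Y, Z} \<rightarrow> carrier M" and s: "s \<in> S"
    and eq: "\<And>W. W \<in> {X, Y, Z} \<Longrightarrow> W = frac (v W) s"
    by (rule common_denominator) blast
  show ?thesis
    by (rule that[of "v X" "v Y" "v Z" s]) (use v s eq in auto)
qed

lemma abelian_group_loc_mod: "abelian_group LM"
proof (rule abelian_groupI)
  fix X Y Z assume XYZ: "X \<in> carrier LM" "Y \<in> carrier LM" "Z \<in> carrier LM"
  obtain x y z s where "x \<in> carrier M" "y \<in> carrier M" "z \<in> carrier M" "s \<in> S"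
    "X = frac x s" "Y = frac y s" "Z = frac z s"
    using common_denominator3[OF XYZ] .
  then show "X \<oplus>\<^bsub>LM\<^esub> Y \<oplus>\<^bsub>LM\<^esub> Z = X \<oplus>\<^bsub>LM\<^esub> (Y \<oplus>\<^bsub>LM\<^esub> Z)"
    by (simp add: frac_add_same M.a_assoc)
next
  fix X Y assume XY: "X \<in> carrier LM" "Y \<in> carrier LM"
  obtain x y z s where "x \<in> carrier M" "y \<in> carrier M" "z \<in> carrier M" "s \<in> S"
    "X = frac x s" "Y = frac y s" "Y = frac z s"
    using common_denominator3[OF XY XY(2)] .
  then show "X \<oplus>\<^bsub>LM\<^esub> Y = Y \<oplus>\<^bsub>LM\<^esub> X" "X \<oplus>\<^bsub>LM\<^esub> Y \<in> carrier LM"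
    by (simp_all add: frac_add_same M.a_comm)
next
  show "\<zero>\<^bsub>LM\<^esub> \<in> carrier LM"
    using frac_zero[OF one_S] by (metis frac_closed one_S M.zero_closed)
next
  fix X assume "X \<in> carrier LM"
  then obtain x s where x: "x \<in> carrier M" "s \<in> S" "X = frac x s" by (rule frac_cases)
  then show "\<zero>\<^bsub>LM\<^esub> \<oplus>\<^bsub>LM\<^esub> X = X"
    \<comment> \<open>Zero is written with the denominator of \<open>X\<close>, so that numerators
      can be added.\<close>
    by (simp add: frac_add_same flip: frac_zero[OF x(2)])
  show "\<exists>Y\<in>carrier LM. Y \<oplus>\<^bsub>LM\<^esub> X = \<zero>\<^bsub>LM\<^esub>"
    using x by (intro bexI[of _ "frac (\<ominus>\<^bsub>M\<^esub> x) s"]) (auto simp: frac_add_same M.l_neg frac_zero)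
qed

end

section \<open>The localized ring\<close>

context localized_cring
begin

text \<open>
  \<open>R\<^sub>S\<close> is the localization of \<open>R\<close> as a module over itself, which transfers the additive structure;
  multiplication in \<open>R\<^sub>S\<close> is then scalar multiplication.
\<close>

definition self_module :: "('a, 'a) module" where
  "self_module = \<lparr>carrier = carrier R, mult = mult R, one = \<one>, zero = \<zero>, add = add R, smult = mult R\<rparr>"

lemma self_module_simps [simp]:
  "carrier self_module = carrier R" "zero self_module = \<zero>" "add self_module = add R"
  "smult self_module = mult R"
  by (simp_all add: self_module_def)

lemma localized_self_module: "localized_module R S self_module"
proof (intro localized_module.intro)
  show "localized_cring R S" by (rule localized_cring_axioms)
  have neg: "\<exists>b\<in>carrier R. a \<oplus> b = \<zero>" if "a \<in> carrier R" for a
    using that R.r_neg by blast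
  show "module R self_module"
    by (rule module_criteria)
       (simp_all add: R.cring_axioms R.a_ac R.m_assoc R.l_distr R.r_distr neg)
qed

interpretation self: localized_module R S self_module
  by (rule localized_self_module)

lemma ring_frac_eq_mod_frac: "rfrac = mod_frac R S self_module"
  by (intro ext) (simp add: ring_frac_def mod_frac_def ring_frac_rel_def mod_frac_rel_def)

text \<open>Rewriting with these equations turns each fact about \<open>frac\<close> over
  \<open>self_module\<close> into one about \<open>rfrac\<close>. The unit is absent from the list
  because the \<open>one\<close> of a \<open>loc_mod\<close> is a zero fraction.\<close>

lemma loc_ring_eq_loc_mod:
  "carrier LR = carrier (loc_mod R S self_module)"
  "zero LR = zero (loc_mod R S self_module)"
  "add LR = add (loc_mod R S self_module)"
  "mult LR = smult (loc_mod R S self_module)"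
  by (simp_all add: loc_ring_def loc_mod_def ring_frac_eq_mod_frac
      ring_frac_rel_def mod_frac_rel_def)

lemma rfrac_mult:
  "a \<in> carrier R \<Longrightarrow> s \<in> S \<Longrightarrow> b \<in> carrier R \<Longrightarrow> t \<in> S \<Longrightarrow>
    rfrac a s \<otimes>\<^bsub>LR\<^esub> rfrac b t = rfrac (a \<otimes> b) (s \<otimes> t)"
  using self.frac_smult by (simp add: loc_ring_eq_loc_mod ring_frac_eq_mod_frac)

lemma rfrac_add_same:
  "a \<in> carrier R \<Longrightarrow> b \<in> carrier R \<Longrightarrow> s \<in> S \<Longrightarrow>
    rfrac a s \<oplus>\<^bsub>LR\<^esub> rfrac b s = rfrac (a \<oplus> b) s"
  using self.frac_add_same by (simp add: loc_ring_eq_loc_mod ring_frac_eq_mod_frac)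

lemma rfrac_closed [simp, intro]: "a \<in> carrier R \<Longrightarrow> s \<in> S \<Longrightarrow> rfrac a s \<in> carrier LR"
  using self.frac_closed by (simp add: loc_ring_eq_loc_mod ring_frac_eq_mod_frac)

lemma rfrac_cancel:
  "a \<in> carrier R \<Longrightarrow> s \<in> S \<Longrightarrow> t \<in> S \<Longrightarrow> rfrac (t \<otimes> a) (t \<otimes> s) = rfrac a s"
  using self.frac_cancel by (simp add: ring_frac_eq_mod_frac)

lemma rfrac_zero: "s \<in> S \<Longrightarrow> rfrac \<zero> s = \<zero>\<^bsub>LR\<^esub>"
  using self.frac_zero by (simp add: loc_ring_eq_loc_mod ring_frac_eq_mod_frac)

lemma rfrac_eq_iff:
  "a \<in> carrier R \<Longrightarrow> s \<in> S \<Longrightarrow> b \<in> carrier R \<Longrightarrow> t \<in> S \<Longrightarrow>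
    rfrac a s = rfrac b t \<longleftrightarrow> (\<exists>u\<in>S. u \<otimes> (t \<otimes> a) = u \<otimes> (s \<otimes> b))"
  using self.frac_eq_iff by (simp add: ring_frac_eq_mod_frac)

lemma rfrac_cases:
  assumes "X \<in> carrier LR"
  obtains a s where "a \<in> carrier R" "s \<in> S" "X = rfrac a s"
  using assms self.frac_cases[of X] by (auto simp: loc_ring_eq_loc_mod ring_frac_eq_mod_frac)

lemma rfrac_common_denominator:
  assumes "finite I" and "c \<in> I \<rightarrow> carrier LR"
  obtains v s where "v \<in> I \<rightarrow> carrier R" "s \<in> S" "\<And>i. i \<in> I \<Longrightarrow> c i = rfrac (v i) s"
  using self.common_denominator[of I c] assms
  by (auto simp: loc_ring_eq_loc_mod ring_frac_eq_mod_frac)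

lemma rfrac_common_denominator2:
  assumes "X \<in> carrier LR" "Y \<in> carrier LR"
  obtains x y s where "x \<in> carrier R" "y \<in> carrier R" "s \<in> S" "X = rfrac x s" "Y = rfrac y s"
  by (rule self.common_denominator3[of X Y Y])
     (use assms that in \<open>auto simp: loc_ring_eq_loc_mod ring_frac_eq_mod_frac\<close>)

lemma rfrac_one: "rfrac \<one> \<one> = \<one>\<^bsub>LR\<^esub>"
  by (simp add: loc_ring_def)

lemma cring_loc_ring: "cring LR"
proof (rule cringI)
  interpret L: abelian_group "loc_mod R S self_module"
    by (rule self.abelian_group_loc_mod)
  have "\<exists>Y\<in>carrier (loc_mod R S self_module). Y \<oplus>\<^bsub>loc_mod R S self_module\<^esub> X = \<zero>\<^bsub>loc_mod R S self_module\<^esub>"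
    if "X \<in> carrier (loc_mod R S self_module)" for X
    using that L.l_neg by blast
  then show "abelian_group LR"
    by (intro abelian_groupI) (simp_all add: loc_ring_eq_loc_mod L.a_ac)
  show "comm_monoid LR"
  proof (rule comm_monoidI)
    fix X Y Z assume "X \<in> carrier LR" "Y \<in> carrier LR" "Z \<in> carrier LR"
    then obtain a s b t c u where "a \<in> carrier R" "s \<in> S" "X = rfrac a s"
      "b \<in> carrier R" "t \<in> S" "Y = rfrac b t" "c \<in> carrier R" "u \<in> S" "Z = rfrac c u"
      by (elim rfrac_cases)
    then show "X \<otimes>\<^bsub>LR\<^esub> Y \<otimes>\<^bsub>LR\<^esub> Z = X \<otimes>\<^bsub>LR\<^esub> (Y \<otimes>\<^bsub>LR\<^esub> Z)"
      by (simp add: rfrac_mult R.m_assoc)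
  next
    fix X Y assume "X \<in> carrier LR" "Y \<in> carrier LR"
    then obtain a s b t where "a \<in> carrier R" "s \<in> S" "X = rfrac a s"
      "b \<in> carrier R" "t \<in> S" "Y = rfrac b t"
      by (elim rfrac_cases)
    then show "X \<otimes>\<^bsub>LR\<^esub> Y = Y \<otimes>\<^bsub>LR\<^esub> X" "X \<otimes>\<^bsub>LR\<^esub> Y \<in> carrier LR"
      by (simp_all add: rfrac_mult R.m_comm)
  next
    show "\<one>\<^bsub>LR\<^esub> \<in> carrier LR" by (simp flip: rfrac_one)
  next
    fix X assume "X \<in> carrier LR"
    then obtain a s where "a \<in> carrier R" "s \<in> S" "X = rfrac a s" by (rule rfrac_cases)
    then show "\<one>\<^bsub>LR\<^esub> \<otimes>\<^bsub>LR\<^esub> X = X"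
      by (simp add: rfrac_mult flip: rfrac_one)
  qed
next
  fix X Y Z assume XYZ: "X \<in> carrier LR" "Y \<in> carrier LR" "Z \<in> carrier LR"
  \<comment> \<open>Only \<open>X\<close> and \<open>Y\<close> need a common denominator: with any
    denominator \<open>t\<close> of \<open>Z\<close>, both products then have denominator
    \<open>s \<otimes> t\<close>.\<close>
  obtain x y s where "x \<in> carrier R" "y \<in> carrier R" "s \<in> S" "X = rfrac x s" "Y = rfrac y s"
    using rfrac_common_denominator2[OF XYZ(1,2)] .
  moreover obtain z t where "z \<in> carrier R" "t \<in> S" "Z = rfrac z t"
    using XYZ(3) by (rule rfrac_cases)
  ultimately show "(X \<oplus>\<^bsub>LR\<^esub> Y) \<otimes>\<^bsub>LR\<^esub> Z = X \<otimes>\<^bsub>LR\<^esub> Z \<oplus>\<^bsub>LR\<^esub> Y \<otimes>\<^bsub>LR\<^esub> Z"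
    by (simp add: rfrac_mult rfrac_add_same R.l_distr)
qed

end

section \<open>The localized module over the localized ring\<close>

lemma (in localized_module) module_loc_mod: "module LR LM"
proof (rule moduleI)
  show "cring LR" by (rule cring_loc_ring)
  show "abelian_group LM" by (rule abelian_group_loc_mod)
next
  fix A X assume "A \<in> carrier LR" "X \<in> carrier LM"
  then obtain a s x t where "a \<in> carrier R" "s \<in> S" "A = rfrac a s"
    "x \<in> carrier M" "t \<in> S" "X = frac x t"
    by (elim rfrac_cases frac_cases)
  then show "A \<odot>\<^bsub>LM\<^esub> X \<in> carrier LM" by (simp add: frac_smult)
next
  fix A B X assume A: "A \<in> carrier LR" "B \<in> carrier LR" and X: "X \<in> carrier LM"
  obtain a b s where "a \<in> carrier R" "b \<in> carrier R" "s \<in> S" "A = rfrac a s" "B = rfrac b s"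
    using rfrac_common_denominator2[OF A] .
  moreover obtain x t where "x \<in> carrier M" "t \<in> S" "X = frac x t" using X by (rule frac_cases)
  ultimately show "(A \<oplus>\<^bsub>LR\<^esub> B) \<odot>\<^bsub>LM\<^esub> X = A \<odot>\<^bsub>LM\<^esub> X \<oplus>\<^bsub>LM\<^esub> B \<odot>\<^bsub>LM\<^esub> X"
    by (simp add: rfrac_add_same frac_smult frac_add_same smult_l_distr)
next
  fix A X Y assume A: "A \<in> carrier LR" and X: "X \<in> carrier LM" "Y \<in> carrier LM"
  obtain x y z t where "x \<in> carrier M" "y \<in> carrier M" "z \<in> carrier M" "t \<in> S"
    "X = frac x t" "Y = frac y t" "Y = frac z t"
    using common_denominator3[OF X X(2)] .
  moreover obtain a s where "a \<in> carrier R" "s \<in> S" "A = rfrac a s" using A by (rule rfrac_cases)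
  ultimately show "A \<odot>\<^bsub>LM\<^esub> (X \<oplus>\<^bsub>LM\<^esub> Y) = A \<odot>\<^bsub>LM\<^esub> X \<oplus>\<^bsub>LM\<^esub> A \<odot>\<^bsub>LM\<^esub> Y"
    by (simp add: frac_smult frac_add_same smult_r_distr)
next
  fix A B X assume "A \<in> carrier LR" "B \<in> carrier LR" "X \<in> carrier LM"
  then obtain a s b t x u where "a \<in> carrier R" "s \<in> S" "A = rfrac a s"
    "b \<in> carrier R" "t \<in> S" "B = rfrac b t" "x \<in> carrier M" "u \<in> S" "X = frac x u"
    by (elim rfrac_cases frac_cases)
  then show "(A \<otimes>\<^bsub>LR\<^esub> B) \<odot>\<^bsub>LM\<^esub> X = A \<odot>\<^bsub>LM\<^esub> (B \<odot>\<^bsub>LM\<^esub> X)"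
    by (simp add: rfrac_mult frac_smult smult_assoc1 R.m_assoc)
next
  fix X assume "X \<in> carrier LM"
  then obtain x s where "x \<in> carrier M" "s \<in> S" "X = frac x s" by (rule frac_cases)
  then show "\<one>\<^bsub>LR\<^esub> \<odot>\<^bsub>LM\<^esub> X = X"
    by (simp add: frac_smult flip: rfrac_one)
qed

section \<open>Vectors over the localized ring as fractions of vectors\<close>

context localized_cring
begin

text \<open>The restriction is there because elements of a function module are extensional: outside
  the index range they take the value \<open>undefined\<close>.\<close>

definition vfrac :: "nat \<Rightarrow> (nat \<Rightarrow> 'a) \<Rightarrow> 'a \<Rightarrow> nat \<Rightarrow> ('a \<times> 'a) set" where
  "vfrac n v s = (\<lambda>i\<in>{..<n}. rfrac (v i) s)"

lemmas free_mod_simps = R.func_space_def ring.func_space_def[OF cring.axioms(1)[OF cring_loc_ring]]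

lemma vfrac_closed [simp, intro]:
  "v \<in> carrier (free_mod R n) \<Longrightarrow> s \<in> S \<Longrightarrow> vfrac n v s \<in> carrier (free_mod LR n)"
  by (auto simp: vfrac_def free_mod_simps)

text \<open>A vector has finitely many coordinates, and these share a denominator.\<close>

lemma vfrac_cases:
  assumes "c \<in> carrier (free_mod LR n)"
  obtains v s where "v \<in> carrier (free_mod R n)" "s \<in> S" "c = vfrac n v s"
proof -
  have "finite {..<n}" "c \<in> {..<n} \<rightarrow> carrier LR" using assms by (auto simp: free_mod_simps)
  then obtain v s where v: "v \<in> {..<n} \<rightarrow> carrier R" and s: "s \<in> S"
    and eq: "\<And>i. i \<in> {..<n} \<Longrightarrow> c i = rfrac (v i) s"
    by (rule rfrac_common_denominator) blast
  have "c = vfrac n (restrict v {..<n}) s"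
    using assms eq by (intro extensionalityI[of _ "{..<n}"]) (auto simp: free_mod_simps vfrac_def PiE_iff)
  moreover have "restrict v {..<n} \<in> carrier (free_mod R n)" using v by (auto simp: free_mod_simps)
  ultimately show ?thesis using s that by blast
qed

text \<open>Each coordinate supplies its own multiplier; as there are only \<open>n\<close> of them,
  one \<open>u\<close> can be found for all coordinates at once.\<close>

lemma vfrac_eq_imp:
  assumes "v \<in> carrier (free_mod R n)" "w \<in> carrier (free_mod R n)" "s \<in> S" "t \<in> S"
    and eq: "vfrac n v s = vfrac n w t"
  obtains u where "u \<in> S" "u \<odot>\<^bsub>free_mod R n\<^esub> (t \<odot>\<^bsub>free_mod R n\<^esub> v) = u \<odot>\<^bsub>free_mod R n\<^esub> (s \<odot>\<^bsub>free_mod R n\<^esub> w)"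
proof -
  have vw: "v i \<in> carrier R" "w i \<in> carrier R" if "i < n" for i
    using that assms by (auto simp: free_mod_simps)
  have "\<exists>u\<in>S. \<forall>i\<in>{..<n}. u \<otimes> (t \<otimes> v i) = u \<otimes> (s \<otimes> w i)"
  proof (rule common_multiple_S)
    fix i assume "i \<in> {..<n}"
    then have i: "i < n" by simp
    have "rfrac (v i) s = rfrac (w i) t" using fun_cong[OF eq, of i] i by (simp add: vfrac_def)
    then show "\<exists>u\<in>S. u \<otimes> (t \<otimes> v i) = u \<otimes> (s \<otimes> w i)"
      using i vw assms by (simp add: rfrac_eq_iff)
  next
    fix i u r assume "i \<in> {..<n}" and u: "u \<otimes> (t \<otimes> v i) = u \<otimes> (s \<otimes> w i)" "u \<in> S" "r \<in> S"
    then have i: "i < n" by simp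
    have "r \<otimes> (u \<otimes> (t \<otimes> v i)) = r \<otimes> (u \<otimes> (s \<otimes> w i))" by (simp only: u(1))
    then show "r \<otimes> u \<otimes> (t \<otimes> v i) = r \<otimes> u \<otimes> (s \<otimes> w i)"
      using u(2,3) i vw assms by (simp add: R.m_assoc)
  qed simp
  then obtain u where "u \<in> S" "\<forall>i\<in>{..<n}. u \<otimes> (t \<otimes> v i) = u \<otimes> (s \<otimes> w i)" ..
  then show ?thesis by (intro that[of u]) (auto simp: free_mod_simps fun_eq_iff)
qed

lemma vfrac_add_same:
  assumes "v \<in> carrier (free_mod R n)" "w \<in> carrier (free_mod R n)" "s \<in> S"
  shows "vfrac n v s \<oplus>\<^bsub>free_mod LR n\<^esub> vfrac n w s = vfrac n (v \<oplus>\<^bsub>free_mod R n\<^esub> w) s"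
  using assms by (auto simp: free_mod_simps vfrac_def fun_eq_iff PiE_iff rfrac_add_same)

lemma vfrac_smult:
  assumes "a \<in> carrier R" "s \<in> S" "v \<in> carrier (free_mod R n)" "t \<in> S"
  shows "rfrac a s \<odot>\<^bsub>free_mod LR n\<^esub> vfrac n v t = vfrac n (a \<odot>\<^bsub>free_mod R n\<^esub> v) (s \<otimes> t)"
  using assms by (auto simp: free_mod_simps vfrac_def fun_eq_iff PiE_iff rfrac_mult)

lemma vfrac_cancel:
  assumes "v \<in> carrier (free_mod R n)" "s \<in> S" "t \<in> S"
  shows "vfrac n (t \<odot>\<^bsub>free_mod R n\<^esub> v) (t \<otimes> s) = vfrac n v s"
  using assms by (auto simp: free_mod_simps vfrac_def fun_eq_iff PiE_iff rfrac_cancel)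

end

section \<open>Localizing a homomorphism from a free module, and its kernel\<close>

locale localized_free_hom = localized_module R S M + hom: mod_hom R "free_mod R n" M f
  for R (structure) and S and n and M (structure) and f
begin

abbreviation "F \<equiv> free_mod R n"
abbreviation "LF \<equiv> free_mod LR n"

text \<open>A definite description avoids choosing a representative; that the value is unique on
  fractions of vectors is the content of \<open>loc_hom_vfrac\<close>.\<close>

definition loc_hom :: "(nat \<Rightarrow> ('a \<times> 'a) set) \<Rightarrow> ('c \<times> 'a) set" where
  "loc_hom c = (THE X. \<exists>v\<in>carrier F. \<exists>s\<in>S. c = vfrac n v s \<and> X = frac (f v) s)"

text \<open>Two representations of one vector agree after cross-multiplication and a further factor
  \<open>u\<close> in \<open>S\<close>. The linear map \<open>f\<close> carries this equation to
  \<open>M\<close>, where it says that the two values are equal.\<close>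

lemma loc_hom_vfrac:
  assumes "v \<in> carrier F" "s \<in> S"
  shows "loc_hom (vfrac n v s) = frac (f v) s"
  unfolding loc_hom_def
proof (rule the_equality)
  fix X assume "\<exists>w\<in>carrier F. \<exists>t\<in>S. vfrac n v s = vfrac n w t \<and> X = frac (f w) t"
  then obtain w t where w: "w \<in> carrier F" "t \<in> S" "vfrac n v s = vfrac n w t" "X = frac (f w) t"
    by blast
  obtain u where u: "u \<in> S" and eq: "u \<odot>\<^bsub>F\<^esub> (t \<odot>\<^bsub>F\<^esub> v) = u \<odot>\<^bsub>F\<^esub> (s \<odot>\<^bsub>F\<^esub> w)"
    using vfrac_eq_imp[OF assms(1) w(1) assms(2) w(2,3)] .
  have "f (u \<odot>\<^bsub>F\<^esub> (t \<odot>\<^bsub>F\<^esub> v)) = f (u \<odot>\<^bsub>F\<^esub> (s \<odot>\<^bsub>F\<^esub> w))" by (simp only: eq)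
  then have "u \<odot>\<^bsub>M\<^esub> (t \<odot>\<^bsub>M\<^esub> f v) = u \<odot>\<^bsub>M\<^esub> (s \<odot>\<^bsub>M\<^esub> f w)"
    using assms w(1,2) u by simp
  then show "X = frac (f v) s"
    using assms w u by (subst eq_commute) (auto simp: frac_eq_iff)
qed (use assms in blast)

lemma mod_hom_loc_hom: "mod_hom LR LF LM loc_hom"
proof (intro mod_hom.intro mod_hom_axioms.intro)
  show "module LR LF" using cring.func_space_is_module[OF cring_loc_ring] .
  show "module LR LM" by (rule module_loc_mod)
  have "loc_hom c \<in> carrier LM" if "c \<in> carrier LF" for c
    using that by (rule vfrac_cases) (simp add: loc_hom_vfrac)
  moreover have "loc_hom (c \<oplus>\<^bsub>LF\<^esub> d) = loc_hom c \<oplus>\<^bsub>LM\<^esub> loc_hom d"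
    if cd: "c \<in> carrier LF" "d \<in> carrier LF" for c d
  proof -
    obtain v s w t where v: "v \<in> carrier F" "s \<in> S" "c = vfrac n v s"
      and w: "w \<in> carrier F" "t \<in> S" "d = vfrac n w t"
      using cd by (elim vfrac_cases)
    \<comment> \<open>Both vectors are expanded to the denominator \<open>s \<otimes> t\<close>,
      over which addition takes place in the numerators.\<close>
    have c: "c = vfrac n (t \<odot>\<^bsub>F\<^esub> v) (s \<otimes> t)"
      using v w vfrac_cancel[of v n s t] by (simp add: R.m_comm)
    have d: "d = vfrac n (s \<odot>\<^bsub>F\<^esub> w) (s \<otimes> t)"
      using v w vfrac_cancel[of w n t s] by simp
    show ?thesis
      using v(1,2) w(1,2) unfolding c d
      by (simp add: vfrac_add_same loc_hom_vfrac frac_add_same)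
  qed
  moreover have "loc_hom (A \<odot>\<^bsub>LF\<^esub> c) = A \<odot>\<^bsub>LM\<^esub> loc_hom c"
    if Ac: "A \<in> carrier LR" "c \<in> carrier LF" for A c
  proof -
    obtain v s a t where "v \<in> carrier F" "s \<in> S" "c = vfrac n v s"
      and "a \<in> carrier R" "t \<in> S" "A = rfrac a t"
      using Ac by (elim vfrac_cases rfrac_cases)
    then show ?thesis by (simp add: vfrac_smult loc_hom_vfrac frac_smult)
  qed
  ultimately show "loc_hom \<in> module_hom LR LF LM"
    by (auto simp: module_hom_def)
qed

interpretation L: mod_hom LR LF LM loc_hom
  by (rule mod_hom_loc_hom)

text \<open>If \<open>f v / s\<close> vanishes, some \<open>u\<close> in \<open>S\<close> kills
  \<open>f v\<close>, hence \<open>u v\<close> lies in the kernel of \<open>f\<close>, and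
  \<open>v/s\<close> equals \<open>(u v)/(u s)\<close>.\<close>

lemma ker_loc_hom: "L.ker = {vfrac n v s | v s. v \<in> hom.ker \<and> s \<in> S}"
proof (intro equalityI subsetI)
  fix c assume "c \<in> L.ker"
  then have c: "c \<in> carrier LF" "loc_hom c = \<zero>\<^bsub>LM\<^esub>" by (auto simp: L.ker_def)
  obtain v s where v: "v \<in> carrier F" "s \<in> S" "c = vfrac n v s" using c(1) by (rule vfrac_cases)
  then obtain u where u: "u \<in> S" "u \<odot>\<^bsub>M\<^esub> f v = \<zero>\<^bsub>M\<^esub>"
    using c(2) by (auto simp: loc_hom_vfrac frac_eq_zero_iff)
  then have "u \<odot>\<^bsub>F\<^esub> v \<in> hom.ker" using v by (simp add: hom.ker_def)
  moreover have "c = vfrac n (u \<odot>\<^bsub>F\<^esub> v) (u \<otimes> s)" using v u by (simp add: vfrac_cancel)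
  moreover have "u \<otimes> s \<in> S" using u v by simp
  ultimately show "c \<in> {vfrac n v s | v s. v \<in> hom.ker \<and> s \<in> S}" by blast
next
  fix c assume "c \<in> {vfrac n v s | v s. v \<in> hom.ker \<and> s \<in> S}"
  then show "c \<in> L.ker" by (auto simp: hom.ker_def L.ker_def loc_hom_vfrac frac_zero)
qed

lemma ker_loc_hom_eq_span:
  assumes A: "A \<subseteq> carrier F" "hom.ker = hom.M.span A"
  shows "L.ker = L.M.span ((\<lambda>v. vfrac n v \<one>) ` A)"
proof (rule equalityI)
  let ?A = "(\<lambda>v. vfrac n v \<one>) ` A"
  have sub: "submodule LR (L.M.span ?A) LF"
    using A by (intro L.M.span_is_submodule) auto
  interpret sp: submodule LR "L.M.span ?A" LF by (rule sub)
  \<comment> \<open>This is the preimage of the span under \<open>v \<mapsto> v/1\<close>. Being a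
    submodule that contains \<open>A\<close>, it contains all of \<open>hom.ker\<close>, without any
    computation with linear combinations.\<close>
  have "submodule R {v \<in> carrier F. vfrac n v \<one> \<in> L.M.span ?A} F"
  proof (unfold_locales, goal_cases)
    case (2 v w)
    then show ?case using sp.m_closed by (simp flip: vfrac_add_same)
  next
    case 3
    have "vfrac n \<zero>\<^bsub>F\<^esub> \<one> = \<zero>\<^bsub>LF\<^esub>"
      by (simp add: vfrac_def free_mod_simps rfrac_zero cong: restrict_cong)
    then show ?case using sp.zero_closed by simp
  next
    case (4 a v)
    then have "vfrac n (a \<odot>\<^bsub>F\<^esub> v) \<one> = rfrac a \<one> \<odot>\<^bsub>LF\<^esub> vfrac n v \<one>"
      by (simp add: vfrac_smult)
    then show ?case using 4 by simp
  qed auto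
  moreover have "A \<subseteq> {v \<in> carrier F. vfrac n v \<one> \<in> L.M.span ?A}"
    using A L.M.in_own_span[of ?A] by auto
  ultimately have span: "hom.M.span A \<subseteq> {v \<in> carrier F. vfrac n v \<one> \<in> L.M.span ?A}"
    by (intro hom.M.span_is_subset)
  show "L.ker \<subseteq> L.M.span ?A"
  proof
    fix c assume "c \<in> L.ker"
    then obtain v s where v: "v \<in> hom.M.span A" "s \<in> S" "c = vfrac n v s"
      using A(2) by (auto simp: ker_loc_hom)
    then have "v \<in> carrier F" "vfrac n v \<one> \<in> L.M.span ?A" using span by auto
    \<comment> \<open>Denominators are absorbed into the scalar \<open>1/s\<close>, so generators of
      the form \<open>v/1\<close> suffice.\<close>
    moreover from this have "c = rfrac \<one> s \<odot>\<^bsub>LF\<^esub> vfrac n v \<one>" using v by (simp add: vfrac_smult)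
    ultimately show "c \<in> L.M.span ?A" using v by simp
  qed
  have "A \<subseteq> hom.ker" using A hom.M.in_own_span[of A] by simp
  then have "?A \<subseteq> L.ker" unfolding ker_loc_hom using one_S by blast
  then show "L.M.span ?A \<subseteq> L.ker"
    using L.M.span_is_subset L.ker_is_submodule by blast
qed

end

section \<open>Finite presentation of the localized module\<close>

lemma (in module) fin_generated_submodule_iff:
  assumes "submodule R K M"
  shows "fin_generated R (M\<lparr>carrier := K\<rparr>) \<longleftrightarrow> (\<exists>A. finite A \<and> A \<subseteq> K \<and> span A = K)"
  \<comment> \<open>For subsets of \<open>K\<close>, the span is the same whether taken in
    \<open>K\<close> or in \<open>M\<close>.\<close>
  using span_li_not_depend(1)[OF _ assms] submodule_is_module[OF assms]
  by (auto simp: fin_generated_def)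

text \<open>The map \<open>f\<close> may fail to be onto \<open>M\<close>: a multiple of each
  element in its image is enough, because elements of \<open>S\<close> become invertible. This
  allows a presentation of a submodule to present all of \<open>LM\<close>.\<close>

lemma (in localized_free_hom) fin_presented_loc_mod_of_hom:
  assumes "fin_generated R (F\<lparr>carrier := hom.ker\<rparr>)"
    and im: "\<And>x. x \<in> carrier M \<Longrightarrow> \<exists>s\<in>S. s \<odot>\<^bsub>M\<^esub> x \<in> hom.im"
  shows "fin_presented LR LM"
  unfolding fin_presented_def
proof (intro exI conjI)
  interpret L: mod_hom LR LF LM loc_hom by (rule mod_hom_loc_hom)
  show "mod_hom LR LF LM loc_hom" ..
  obtain A where A: "finite A" "A \<subseteq> hom.ker" "hom.M.span A = hom.ker"
    using assms(1) hom.M.fin_generated_submodule_iff[OF hom.ker_is_submodule] by blast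
  have "A \<subseteq> carrier F" using A(2) by (auto simp: hom.ker_def)
  then have "L.ker = L.M.span ((\<lambda>v. vfrac n v \<one>) ` A)"
    using A(3) by (intro ker_loc_hom_eq_span) auto
  moreover have "(\<lambda>v. vfrac n v \<one>) ` A \<subseteq> L.ker" unfolding ker_loc_hom using A(2) one_S by blast
  ultimately show "fin_generated LR (LF\<lparr>carrier := L.ker\<rparr>)"
    unfolding L.M.fin_generated_submodule_iff[OF L.ker_is_submodule]
    using A(1) by (metis finite_imageI)
  show "L.im = carrier LM"
  proof (intro equalityI subsetI)
    fix X assume "X \<in> carrier LM"
    then obtain x t where x: "x \<in> carrier M" "t \<in> S" "X = frac x t" by (rule frac_cases)
    then obtain s v where v: "s \<in> S" "v \<in> carrier F" "s \<odot>\<^bsub>M\<^esub> x = f v"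
      using im[of x] by (auto simp: hom.im_def)
    have "X = frac (s \<odot>\<^bsub>M\<^esub> x) (s \<otimes> t)" using x v(1) by (simp add: frac_cancel)
    also have "\<dots> = loc_hom (vfrac n v (s \<otimes> t))" using x v by (simp add: loc_hom_vfrac)
    finally show "X \<in> L.im" using x v by (simp add: L.im_def)
  qed (auto simp: L.im_def)
qed

section \<open>Submodules containing a multiple of every element\<close>

context localized_module
begin

text \<open>The presentation of \<open>N\<close> is composed with the inclusion into
  \<open>M\<close> before localizing, so that it leads straight to \<open>LM\<close>.\<close>

lemma fin_presented_loc_mod:
  assumes N: "submodule R N M" and fp: "fin_presented R (M\<lparr>carrier := N\<rparr>)"
    and tors: "\<And>x. x \<in> carrier M \<Longrightarrow> \<exists>s\<in>S. s \<odot>\<^bsub>M\<^esub> x \<in> N"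
  shows "fin_presented LR LM"
proof -
  obtain n f where f: "mod_hom R (free_mod R n) (M\<lparr>carrier := N\<rparr>) f"
    and im: "mod_hom.im (free_mod R n) f = N"
    and ker: "fin_generated R ((free_mod R n)\<lparr>carrier := mod_hom.ker (free_mod R n) (M\<lparr>carrier := N\<rparr>) f\<rparr>)"
    using fp by (auto simp: fin_presented_def)
  interpret f: mod_hom R "free_mod R n" "M\<lparr>carrier := N\<rparr>" f by (rule f)
  have "N \<subseteq> carrier M" using N by (rule submodule.subset)
  then have "mod_hom R (free_mod R n) M f"
    using f.f_hom by (intro mod_hom.intro mod_hom_axioms.intro f.M.module_axioms module_axioms)
      (auto simp: module_hom_def)
  then interpret g: localized_free_hom R S n M f
    by (intro localized_free_hom.intro localized_module_axioms)
  \<comment> \<open>\<open>N\<close> and \<open>M\<close> have the same zero, so enlarging the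
    target leaves the kernel unchanged and its generators remain available.\<close>
  have "g.hom.ker = f.ker" by (simp add: g.hom.ker_def f.ker_def)
  then show ?thesis
    using g.fin_presented_loc_mod_of_hom ker tors im by simp
qed

lemma carrier_loc_mod_eq_loc_submod_iff:
  assumes "submodule R N M"
  shows "carrier LM = loc_submod R S M N \<longleftrightarrow> (\<forall>x\<in>carrier M. \<exists>s\<in>S. s \<odot>\<^bsub>M\<^esub> x \<in> N)"
proof -
  interpret N: submodule R N M by (rule assms)
  show ?thesis
  proof (intro iffI ballI)
    fix x assume eq: "carrier LM = loc_submod R S M N" and x: "x \<in> carrier M"
    \<comment> \<open>Testing the equality on \<open>x/1 = y/t\<close> gives
      \<open>u t x = u y\<close>, which lies in \<open>N\<close>; the multiplier is
      \<open>u \<otimes> t\<close>.\<close>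
    then have "frac x \<one> \<in> loc_submod R S M N" by auto
    then obtain y t where y: "y \<in> N" "t \<in> S" "frac x \<one> = frac y t"
      by (auto simp: loc_submod_def)
    then have yM: "y \<in> carrier M" using N.subset by auto
    then obtain u where u: "u \<in> S" "u \<odot>\<^bsub>M\<^esub> (t \<odot>\<^bsub>M\<^esub> x) = u \<odot>\<^bsub>M\<^esub> (\<one> \<odot>\<^bsub>M\<^esub> y)"
      using x y frac_eq_iff[of x \<one> y t] by auto
    then have "(u \<otimes> t) \<odot>\<^bsub>M\<^esub> x \<in> N" using x y yM by (simp add: smult_assoc1)
    then show "\<exists>s\<in>S. s \<odot>\<^bsub>M\<^esub> x \<in> N" using u(1) y(2) mult_S by blast
  next
    assume tors: "\<forall>x\<in>carrier M. \<exists>s\<in>S. s \<odot>\<^bsub>M\<^esub> x \<in> N"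
    show "carrier LM = loc_submod R S M N"
    proof (intro equalityI subsetI)
      fix X assume "X \<in> carrier LM"
      then obtain x t where x: "x \<in> carrier M" "t \<in> S" "X = frac x t" by (rule frac_cases)
      then obtain s where s: "s \<in> S" "s \<odot>\<^bsub>M\<^esub> x \<in> N" using tors by blast
      \<comment> \<open>Expanding by the multiplier \<open>s\<close> brings the numerator into
        \<open>N\<close>.\<close>
      have "X = frac (s \<odot>\<^bsub>M\<^esub> x) (s \<otimes> t)" using x s(1) by (simp add: frac_cancel)
      moreover have "s \<otimes> t \<in> S" using s x by simp
      ultimately show "X \<in> loc_submod R S M N" using s(2) unfolding loc_submod_def by blast
    next
      fix X assume "X \<in> loc_submod R S M N"
      then show "X \<in> carrier LM" using N.subset by (auto simp: loc_submod_def)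
    qed
  qed
qed

lemma uniform_multiplier:
  assumes "fin_generated R M" and N: "submodule R N M"
    and tors: "\<And>x. x \<in> carrier M \<Longrightarrow> \<exists>s\<in>S. s \<odot>\<^bsub>M\<^esub> x \<in> N"
  shows "\<exists>s\<in>S. (\<lambda>x. s \<odot>\<^bsub>M\<^esub> x) ` carrier M \<subseteq> N"
proof -
  interpret N: submodule R N M by (rule N)
  obtain A where A: "finite A" "A \<subseteq> carrier M" "span A = carrier M"
    using assms(1) by (auto simp: fin_generated_def)
  have "\<exists>s\<in>S. \<forall>a\<in>A. a \<in> carrier M \<and> s \<odot>\<^bsub>M\<^esub> a \<in> N"
    by (rule common_multiple_S) (use A tors in \<open>auto simp: smult_assoc1\<close>)
  then obtain s where s: "s \<in> S" "\<forall>a\<in>A. s \<odot>\<^bsub>M\<^esub> a \<in> N" by blast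
  \<comment> \<open>With \<open>s\<close> fixed, these elements form a submodule because
    \<open>R\<close> is commutative; as it contains the generators, it is all of
    \<open>M\<close>.\<close>
  have "submodule R {x \<in> carrier M. s \<odot>\<^bsub>M\<^esub> x \<in> N} M"
    by unfold_locales (use s(1) in \<open>auto simp: smult_r_distr smult_left_commute[of s]\<close>)
  then have "span A \<subseteq> {x \<in> carrier M. s \<odot>\<^bsub>M\<^esub> x \<in> N}"
    by (rule span_is_subset[rotated]) (use A s in auto)
  then show ?thesis using A s by auto
qed

end

theorem proposition4p3:
  fixes R :: "('a, 'r) ring_scheme"
    and S :: "'a set"
    and M :: "('a, 'b, 'm) module_scheme"
  assumes "cring R" and "submonoid S R" and "module R M"
  shows "(c_S_fin_presented R S M \<longrightarrow> fin_presented (loc_ring R S) (loc_mod R S M)) \<and>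
         (fin_generated R M \<longrightarrow>
            (c_S_fin_presented R S M \<longleftrightarrow>
               (\<exists>N. submodule R N M \<and> fin_presented R (M\<lparr>carrier := N\<rparr>) \<and>
                    carrier (loc_mod R S M) = loc_submod R S M N)))"
proof -
  interpret localized_module R S M
    using assms by (intro localized_module.intro localized_cring.intro localized_cring_axioms.intro)
  \<comment> \<open>The quantifier over \<open>s\<close> is moved inward, leaving a condition on
    \<open>N\<close> to be compared with equality of localizations for the same
    \<open>N\<close>.\<close>
  have c_S: "c_S_fin_presented R S M \<longleftrightarrow>
    (\<exists>N. submodule R N M \<and> fin_presented R (M\<lparr>carrier := N\<rparr>) \<and>
      (\<exists>s\<in>S. (\<lambda>x. s \<odot>\<^bsub>M\<^esub> x) ` carrier M \<subseteq> N))"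
    by (auto simp: c_S_fin_presented_def)
  show ?thesis
  proof (intro conjI impI iffI)
    assume "c_S_fin_presented R S M"
    then obtain N where "submodule R N M" "fin_presented R (M\<lparr>carrier := N\<rparr>)"
      "\<exists>s\<in>S. (\<lambda>x. s \<odot>\<^bsub>M\<^esub> x) ` carrier M \<subseteq> N"
      unfolding c_S by blast
    then show "fin_presented (loc_ring R S) (loc_mod R S M)"
      by (intro fin_presented_loc_mod[of N]) blast+
  next
    assume "c_S_fin_presented R S M"
    then obtain N where N: "submodule R N M" "fin_presented R (M\<lparr>carrier := N\<rparr>)"
      "\<exists>s\<in>S. (\<lambda>x. s \<odot>\<^bsub>M\<^esub> x) ` carrier M \<subseteq> N"
      unfolding c_S by blast
    \<comment> \<open>A uniform multiplier serves for each element, and this pointwise form amounts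
      to equality of the localizations.\<close>
    then have "\<forall>x\<in>carrier M. \<exists>s\<in>S. s \<odot>\<^bsub>M\<^esub> x \<in> N" by blast
    with N show "\<exists>N. submodule R N M \<and> fin_presented R (M\<lparr>carrier := N\<rparr>) \<and>
        carrier (loc_mod R S M) = loc_submod R S M N"
      using carrier_loc_mod_eq_loc_submod_iff by blast
  next
    assume "fin_generated R M"
      and "\<exists>N. submodule R N M \<and> fin_presented R (M\<lparr>carrier := N\<rparr>) \<and>
        carrier (loc_mod R S M) = loc_submod R S M N"
    \<comment> \<open>Equality of the localizations gives a multiplier for each element; finite
      generation makes it uniform.\<close>
    then show "c_S_fin_presented R S M"
      unfolding c_S using uniform_multiplier carrier_loc_mod_eq_loc_submod_iff by metis
  qed
qed

end
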